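(* Let $\mathcal{S}$ be a trajectory set for which assumption $(L)$-a.e. holds, and let $\{f_j\}_{j\ge0}$ be a real-valued supermartingale on $\mathcal{S}$. Let $\rho,\tau$ be two stopping times with $\rho\le\tau$ a.e., and suppose $\tau\le C$ a.e. for some non-negative integer $C$. Then $$\overline{\sigma}_\rho f_\tau\le f_\rho\quad\text{a.e. on }\mathcal{S}.$$
   Context: Fix $s_0\in\mathbb{R}$. A trajectory set $\mathcal{S}$ is a set of real sequences $S=(S_i)_{i\ge 0}$ with $S_0=s_0$. For $S\in\mathcal{S}$ and an integer $j\ge 0$, the node $(S,j)$ stands for $\mathcal{S}_{(S,j)}=\{\tilde S\in\mathcal{S}:\tilde S_i=S_i,\ 0\le i\le j\}$; also $\mathcal{S}_{(S,\infty)}=\{S\}$. $\mathcal{H}_{(S,j)}$ is the set of sequences $H=(H_i)_{i\ge j}$ of functions $H_i:\mathcal{S}_{(S,j)}\to\mathbb{R}$ that are non-anticipative: $H_i(\tilde S)=H_i(\hat S)$ whenever $\tilde S_k=\hat S_k$ for $j\le k\le i$. For $V\in\mathbb{R}$, $H\in\mathcal{H}_{(S,j)}$, $n\ge j$, put $\Pi^{V,H}_{j,n}(\tilde S)=V+\sum_{i=j}^{n-1}H_i(\tilde S)(\tilde S_{i+1}-\tilde S_i)$ for $\tilde S\in\mathcal{S}_{(S,j)}$. $\mathcal{E}_{(S,j)}$ is the set of all such functions $\Pi^{V,H}_{j,n}$, and $\mathcal{E}^+_{(S,j)}$ the set of its non-negative elements. $Q$ is the set of all functions $\mathcal{S}\to[-\infty,\infty]$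 and $P\subseteq Q$ the set of non-negative ones. Conventions: $0\cdot(\pm\infty)=0$, $\infty+(-\infty)=\infty$, $u-v=u+(-v)$, $\inf\emptyset=\infty$. For $f\in Q$ and a node $(S,j)$, $\overline{\sigma}_jf(S)=\inf\sum_{m\ge 0}V^m$, the infimum being over all choices of $f_0=\Pi^{V^0,H^0}_{j,n_0}\in\mathcal{E}_{(S,j)}$ and, for $m\ge1$, $f_m=\liminf_{n\to\infty}\Pi^{V^m,H^m}_{j,n}$ with $\Pi^{V^m,H^m}_{j,n}\in\mathcal{E}^+_{(S,j)}$ for all $n\ge j$, such that $f\le\sum_{m\ge0}f_m$ on $\mathcal{S}_{(S,j)}$. Put $\overline{\sigma}_\infty f(S)=f(S)$. For $f\in P$, $\overline{I}_jf(S)=\inf\sum_{m\ge1}V^m$ over all $f_m=\liminf_{n\to\infty}\Pi^{V^m,H^m}_{j,n}$, $m\ge1$, with $\Pi^{V^m,H^m}_{j,n}\in\mathcal{E}^+_{(S,j)}$ for all $n\ge j$, such that $f\le\sum_{m\ge1}f_m$ on $\mathcal{S}_{(S,j)}$. Since all trajectories start at $s_0$, $\overline{I}f:=\overline{I}_0f$ is a number. A set $E\subseteq\mathcal{S}$ is null if $\overline{I}(\mathbf{1}_E)=0$; a property holds a.e. if it holds off a null set. Property $(L_{(S,j)})$: whenever $\Pi^{V,H}_{j,n_f}\in\mathcal{E}_{(S,j)}$ and $f_m=\liminf_{n\to\infty}\Pi^{V^m,H^m}_{j,n}$ with $\Pi^{V^m,H^m}_{j,n}\in\mathcal{E}^+_{(S,j)}$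 for all $n\ge j$, $m\ge1$, satisfy $\Pi^{V,H}_{j,n_f}\le\sum_{m\ge1}f_m$ on $\mathcal{S}_{(S,j)}$, then $V\le\sum_{m\ge1}V^m$. Assumption $(L)$-a.e.: $(L_{(S,0)})$ holds, and $\{S\in\mathcal{S}:\exists j\ge0\text{ such that }(L_{(S,j)})\text{ fails}\}$ is a null set. A sequence $\{f_j\}_{j\ge0}$ in $Q$ is non-anticipative if $f_j$ is constant on $\mathcal{S}_{(S,j)}$ for all $S\in\mathcal S$, $j\ge 0$; a non-anticipative sequence is a supermartingale if for each $j\ge0$, $\overline{\sigma}_jf_{j+1}\le f_j$ a.e. A stopping time is a function $\tau:\mathcal{S}\to\{0,1,2,\dots\}\cup\{\infty\}$ such that for all $S,S'\in\mathcal{S}$, if $S_k=S'_k$ for all $0\le k\le\tau(S)$ (all $k\geq 0$ if $\tau(S)=\infty$), then $\tau(S)=\tau(S')$. For a stopping time $\tau$, $\overline{\sigma}_\tau g(S)=\overline{\sigma}_{\tau(S)}g(S)$ for $g\in Q$. If $\tau<\infty$ a.e., $f_\tau(S)=f_{\tau(S)}(S)$ is defined a.e. (its values on the null set $\{\tau=\infty\}$ are arbitrary). *)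

theory Defs
  imports Complex_Main "HOL-Library.Extended_Nat" "HOL-Library.Extended_Real"
    "HOL-Library.Indicator_Function" "HOL-Library.Liminf_Limsup"
begin

type_synonym traj = "nat \<Rightarrow> real"

definition trajectory_set :: "real \<Rightarrow> traj set \<Rightarrow> bool" where
  "trajectory_set s0 \<S> \<longleftrightarrow> (\<forall>S\<in>\<S>. S 0 = s0)"

definition node :: "traj set \<Rightarrow> traj \<Rightarrow> nat \<Rightarrow> traj set" where
  "node \<S> S j = {S'\<in>\<S>. \<forall>i\<le>j. S' i = S i}"

text \<open>
  The notions below that live on a node $(S,j)$ take the trajectories \<open>N = node \<S> S j\<close> and the
  time \<open>j\<close> as arguments. Functions on \<open>N\<close> or on \<open>\<S>\<close> are total functions on \<open>traj\<close> of which only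
  the values on \<open>N\<close> or on \<open>\<S>\<close> are ever used; likewise \<open>H i\<close> is only used for \<open>i \<ge> j\<close>.
\<close>

definition strategies :: "traj set \<Rightarrow> nat \<Rightarrow> (nat \<Rightarrow> traj \<Rightarrow> real) set" where
  "strategies N j = {H. \<forall>i\<ge>j. \<forall>S\<in>N. \<forall>S'\<in>N.
     (\<forall>k. j \<le> k \<and> k \<le> i \<longrightarrow> S k = S' k) \<longrightarrow> H i S = H i S'}"

definition portfolio ::
  "nat \<Rightarrow> real \<Rightarrow> (nat \<Rightarrow> traj \<Rightarrow> real) \<Rightarrow> nat \<Rightarrow> traj \<Rightarrow> real" where
  "portfolio j V H n S = V + (\<Sum>i=j..<n. H i S * (S (Suc i) - S i))"

text \<open>All of the portfolios $\Pi^{V,H}_{j,n}$, $n \ge j$, belong to $\mathcal{E}^+$.\<close>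

definition nonneg_portfolios ::
  "traj set \<Rightarrow> nat \<Rightarrow> real \<Rightarrow> (nat \<Rightarrow> traj \<Rightarrow> real) \<Rightarrow> bool" where
  "nonneg_portfolios N j V H \<longleftrightarrow>
     H \<in> strategies N j \<and> (\<forall>n\<ge>j. \<forall>S\<in>N. 0 \<le> portfolio j V H n S)"

definition liminf_portfolio ::
  "nat \<Rightarrow> real \<Rightarrow> (nat \<Rightarrow> traj \<Rightarrow> real) \<Rightarrow> traj \<Rightarrow> ereal" where
  "liminf_portfolio j V H S = liminf (\<lambda>n. ereal (portfolio j V H n S))"

text \<open>
  The countable families indexed by $m \ge 1$ in the mathematical definitions are indexed by
  \<open>m :: nat\<close> starting from \<open>0\<close> here, and the element with index $0$ in the definition of
  $\overline{\sigma}$ is kept apart as \<open>V0\<close>, \<open>H0\<close>, \<open>n0\<close>. For nonempty \<open>N\<close>, all infinite sums therefore have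
  nonnegative terms. Addition on \<open>ereal\<close> satisfies \<open>\<infinity> + (-\<infinity>) = \<infinity>\<close>, and \<open>Inf {} = \<infinity>\<close>.
\<close>

definition sigma_node :: "traj set \<Rightarrow> nat \<Rightarrow> (traj \<Rightarrow> ereal) \<Rightarrow> ereal" where
  "sigma_node N j f = Inf {ereal V0 + (\<Sum>m. ereal (V m)) | V0 H0 n0 V H.
     H0 \<in> strategies N j \<and> n0 \<ge> j \<and> (\<forall>m. nonneg_portfolios N j (V m) (H m)) \<and>
     (\<forall>S\<in>N. f S \<le> ereal (portfolio j V0 H0 n0 S) + (\<Sum>m. liminf_portfolio j (V m) (H m) S))}"

definition I_node :: "traj set \<Rightarrow> nat \<Rightarrow> (traj \<Rightarrow> ereal) \<Rightarrow> ereal" where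
  "I_node N j f = Inf {(\<Sum>m. ereal (V m)) | V H.
     (\<forall>m. nonneg_portfolios N j (V m) (H m)) \<and>
     (\<forall>S\<in>N. f S \<le> (\<Sum>m. liminf_portfolio j (V m) (H m) S))}"

definition L_node :: "traj set \<Rightarrow> nat \<Rightarrow> bool" where
  "L_node N j \<longleftrightarrow> (\<forall>V0 H0 n0 V H.
     H0 \<in> strategies N j \<and> n0 \<ge> j \<and> (\<forall>m. nonneg_portfolios N j (V m) (H m)) \<and>
     (\<forall>S\<in>N. ereal (portfolio j V0 H0 n0 S) \<le> (\<Sum>m. liminf_portfolio j (V m) (H m) S))
     \<longrightarrow> ereal V0 \<le> (\<Sum>m. ereal (V m)))"

definition sigma_bar :: "traj set \<Rightarrow> enat \<Rightarrow> (traj \<Rightarrow> ereal) \<Rightarrow> traj \<Rightarrow> ereal" where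
  "sigma_bar \<S> t f S = (case t of enat j \<Rightarrow> sigma_node (node \<S> S j) j f | \<infinity> \<Rightarrow> f S)"

definition sigma_bar_stop ::
  "traj set \<Rightarrow> (traj \<Rightarrow> enat) \<Rightarrow> (traj \<Rightarrow> ereal) \<Rightarrow> traj \<Rightarrow> ereal" where
  "sigma_bar_stop \<S> \<tau> g S = sigma_bar \<S> (\<tau> S) g S"

text \<open>
  Every node at time \<open>0\<close> is \<open>\<S>\<close> itself, so $\overline{I} = \overline{I}_0$ is computed on \<open>\<S>\<close>.
\<close>

lemma node_0:
  assumes "trajectory_set s0 \<S>" "S \<in> \<S>"
  shows "node \<S> S 0 = \<S>"
proof -
  have "S' 0 = S 0" if "S' \<in> \<S>" for S'
    using assms that unfolding trajectory_set_def by metis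
  then show ?thesis
    by (auto simp: node_def)
qed

definition I_bar :: "traj set \<Rightarrow> (traj \<Rightarrow> ereal) \<Rightarrow> ereal" where
  "I_bar \<S> f = I_node \<S> 0 f"

definition null_set :: "traj set \<Rightarrow> traj set \<Rightarrow> bool" where
  "null_set \<S> E \<longleftrightarrow> E \<subseteq> \<S> \<and> I_bar \<S> (indicator E) = 0"

definition ae :: "traj set \<Rightarrow> (traj \<Rightarrow> bool) \<Rightarrow> bool" where
  "ae \<S> P \<longleftrightarrow> (\<exists>E. null_set \<S> E \<and> (\<forall>S\<in>\<S> - E. P S))"

definition L_ae :: "traj set \<Rightarrow> bool" where
  "L_ae \<S> \<longleftrightarrow> (\<forall>S\<in>\<S>. L_node (node \<S> S 0) 0) \<and>
     null_set \<S> {S\<in>\<S>. \<exists>j. \<not> L_node (node \<S> S j) j}"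

definition nonanticipative :: "traj set \<Rightarrow> (nat \<Rightarrow> traj \<Rightarrow> ereal) \<Rightarrow> bool" where
  "nonanticipative \<S> f \<longleftrightarrow> (\<forall>S\<in>\<S>. \<forall>j. \<forall>S'\<in>node \<S> S j. f j S' = f j S)"

definition supermartingale :: "traj set \<Rightarrow> (nat \<Rightarrow> traj \<Rightarrow> ereal) \<Rightarrow> bool" where
  "supermartingale \<S> f \<longleftrightarrow> nonanticipative \<S> f \<and>
     (\<forall>j. ae \<S> (\<lambda>S. sigma_bar \<S> (enat j) (f (Suc j)) S \<le> f j S))"

definition stopping_time :: "traj set \<Rightarrow> (traj \<Rightarrow> enat) \<Rightarrow> bool" where
  "stopping_time \<S> \<tau> \<longleftrightarrow> (\<forall>S\<in>\<S>. \<forall>S'\<in>\<S>.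
     (\<forall>k. enat k \<le> \<tau> S \<longrightarrow> S k = S' k) \<longrightarrow> \<tau> S = \<tau> S')"

text \<open>
  \<open>g\<close> is a version of $f_\tau$: its values on $\{\tau = \infty\}$ are unconstrained.
\<close>

definition is_stopped ::
  "traj set \<Rightarrow> (nat \<Rightarrow> traj \<Rightarrow> ereal) \<Rightarrow> (traj \<Rightarrow> enat) \<Rightarrow> (traj \<Rightarrow> ereal) \<Rightarrow> bool" where
  "is_stopped \<S> f \<tau> g \<longleftrightarrow> (\<forall>S\<in>\<S>. \<forall>j. \<tau> S = enat j \<longrightarrow> g S = f j S)"

end

(* Off a null set, property L at the successor node (S, i+1) turns the inequality for
   sigma-bar at (S, i) into a superhedge over a single time step; if the price can move both
   up and down from (S, i), the countably many positions of that superhedge are absolutely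
   summable and amount to one position h, so that f_{i+1} <= f_i + epsilon + h (S_{i+1} - S_i).
   Nodes with moves in one direction only are harmless, because the trajectories that do move
   there form a null set. Holding h until time tau telescopes these inequalities into a
   superhedge of f_tau from time rho. The exceptional null set is covered by a family of
   arbitrarily small cost that is infinite on it; such families survive the passage to a later
   node off a null set. *)

theory Submission
  imports Defs "HOL-Analysis.Caratheodory"
begin

section \<open>Series of nonnegative extended reals\<close>

lemma suminf_ereal_2dimen:
  fixes f :: "nat \<times> nat \<Rightarrow> ereal"
  assumes "\<And>p. 0 \<le> f p"
  shows "(\<Sum>i. f (prod_decode i)) = (\<Sum>k m. f (k, m))"
proof -
  \<comment> \<open>Nonnegative terms lift to \<open>ennreal\<close>, where a double series may be
    enumerated along \<open>prod_decode\<close>.\<close>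
  have f: "f = (\<lambda>p. enn2ereal (e2ennreal (f p)))"
    using assms by (simp add: enn2ereal_e2ennreal)
  have "(\<Sum>i. e2ennreal (f (prod_decode i))) = (\<Sum>k m. e2ennreal (f (k, m)))"
    by (rule suminf_ennreal_2dimen) simp
  then show ?thesis
    by (subst (1 2) f) (simp only: suminf_enn2ereal)
qed

lemma suminf_const_ereal:
  assumes "0 < c"
  shows "(\<Sum>n::nat. ereal c) = \<infinity>"
proof (rule ccontr)
  assume "(\<Sum>n::nat. ereal c) \<noteq> \<infinity>"
  then have "summable (\<lambda>n::nat. c)"
    using assms by (intro summable_ereal) auto
  then show False
    using assms by (simp add: summable_const_iff)
qed

section \<open>Nodes and portfolios: splitting, stopping, scaling, restarting\<close>

lemma self_in_node: "S \<in> \<S> \<Longrightarrow> S \<in> node \<S> S j"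
  by (simp add: node_def)

lemma node_eq: "S' \<in> node \<S> S j \<Longrightarrow> node \<S> S' j = node \<S> S j"
  by (auto simp: node_def)

lemma node_subset: "S' \<in> node \<S> S j \<Longrightarrow> j \<le> i \<Longrightarrow> node \<S> S' i \<subseteq> node \<S> S j"
  by (auto simp: node_def)

lemma node_agree: "S' \<in> node \<S> S j \<Longrightarrow> i \<le> j \<Longrightarrow> S' i = S i"
  by (auto simp: node_def)

lemma portfolio_split:
  "j \<le> i \<Longrightarrow> i \<le> n \<Longrightarrow> portfolio j V H n S = portfolio i (portfolio j V H i S) H n S"
  by (simp add: portfolio_def sum.atLeastLessThan_concat)

text \<open>Dropping all positions from time \<open>i\<close> on freezes the portfolio at its value
  then. This serves both to raise a maturity without changing the payoff and to express the value at
  a fixed time as a limit inferior.\<close>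

lemma portfolio_stopped:
  "portfolio j V (\<lambda>k S. if k < i then H k S else 0) n S = portfolio j V H (min n i) S"
proof -
  have "(\<Sum>k=j..<n. (if k < i then H k S else 0) * (S (Suc k) - S k))
      = (\<Sum>k=j..<min n i. H k S * (S (Suc k) - S k))"
    by (rule sum.mono_neutral_cong_right) auto
  then show ?thesis
    by (simp add: portfolio_def)
qed

lemma portfolio_scale:
  "portfolio j (c * V) (\<lambda>i S. c * H i S) n S = c * portfolio j V H n S"
  by (simp add: portfolio_def distrib_left sum_distrib_left mult.assoc)

lemma strategiesI:
  assumes "\<And>i S S'. j \<le> i \<Longrightarrow> S \<in> N \<Longrightarrow> S' \<in> N \<Longrightarrow> (\<And>k. j \<le> k \<Longrightarrow> k \<le> i \<Longrightarrow> S k = S' k)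
    \<Longrightarrow> H i S = H i S'"
  shows "H \<in> strategies N j"
  unfolding strategies_def mem_Collect_eq by (intro allI impI ballI assms) blast+

lemma strategiesD:
  assumes "H \<in> strategies N j" "j \<le> i" "S \<in> N" "S' \<in> N" "\<And>k. j \<le> k \<Longrightarrow> k \<le> i \<Longrightarrow> S k = S' k"
  shows "H i S = H i S'"
  using assms unfolding strategies_def mem_Collect_eq by blast

lemma strategies_stopped:
  assumes "H \<in> strategies N j"
  shows "(\<lambda>k S. if k < i then H k S else 0) \<in> strategies N j"
proof (rule strategiesI)
  fix k S S'
  assume "j \<le> k" "S \<in> N" "S' \<in> N" "\<And>l. j \<le> l \<Longrightarrow> l \<le> k \<Longrightarrow> S l = S' l"
  then have "H k S = H k S'"
    by (rule strategiesD [OF assms])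
  then show "(if k < i then H k S else 0) = (if k < i then H k S' else 0)"
    by simp
qed

lemma strategies_scale:
  assumes "H \<in> strategies N j"
  shows "(\<lambda>k S. c * H k S) \<in> strategies N j"
  by (intro strategiesI arg_cong [where f = "(*) c"] strategiesD [OF assms])

lemma strategies_eq:
  assumes "H \<in> strategies (node \<S> S j) j" "S' \<in> node \<S> S j" "S'' \<in> node \<S> S' i" "j \<le> i"
  shows "H i S'' = H i S'"
proof -
  have "S'' \<in> node \<S> S j"
    using node_subset assms by blast
  then show ?thesis
    using strategiesD [OF assms(1,4)] assms(2) node_agree [OF assms(3)] by blast
qed

lemma portfolio_eq:
  assumes "H \<in> strategies (node \<S> S j) j" "S' \<in> node \<S> S j" "S'' \<in> node \<S> S' i"
  shows "portfolio j V H i S'' = portfolio j V H i S'"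
proof -
  have "H k S'' * (S'' (Suc k) - S'' k) = H k S' * (S' (Suc k) - S' k)" if "j \<le> k" "k < i" for k
  proof -
    have "S'' \<in> node \<S> S' k"
      using assms(3) that by (auto simp: node_def)
    then show ?thesis
      using strategies_eq [OF assms(1,2)] node_agree [OF assms(3)] that by simp
  qed
  then show ?thesis
    unfolding portfolio_def by (intro arg_cong2 [where f = "(+)"] sum.cong) auto
qed

text \<open>Trajectories through the later node share the whole past up to time \<open>i\<close>, so
  agreement from \<open>i\<close> on already is agreement from \<open>j\<close> on.\<close>

lemma strategies_later:
  assumes "H \<in> strategies (node \<S> S j) j" "S' \<in> node \<S> S j" "j \<le> i"
  shows "H \<in> strategies (node \<S> S' i) i"
proof (rule strategiesI)
  fix k S1 S2
  assume "i \<le> k" and S12: "S1 \<in> node \<S> S' i" "S2 \<in> node \<S> S' i"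
    and eq: "\<And>l. i \<le> l \<Longrightarrow> l \<le> k \<Longrightarrow> S1 l = S2 l"
  have "S1 l = S2 l" if "l \<le> k" for l
    using eq that node_agree [OF S12(1), of l] node_agree [OF S12(2), of l] by (cases "i \<le> l") auto
  then have "S1 \<in> node \<S> S2 k"
    using S12 by (auto simp: node_def)
  moreover have "S2 \<in> node \<S> S j"
    using S12 node_subset assms by blast
  ultimately show "H k S1 = H k S2"
    using strategies_eq assms \<open>i \<le> k\<close> by (meson order_trans)
qed

text \<open>The capital at the restart is the current value of the portfolio, which is the same for
  all trajectories through the later node; the restarted portfolio therefore has the old
  values.\<close>

lemma nonneg_portfolios_later:
  assumes "nonneg_portfolios (node \<S> S j) j V H" "S' \<in> node \<S> S j" "j \<le> i"
  shows "nonneg_portfolios (node \<S> S' i) i (portfolio j V H i S') H"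
  unfolding nonneg_portfolios_def
proof (intro conjI allI impI ballI)
  have H: "H \<in> strategies (node \<S> S j) j"
    using assms by (simp add: nonneg_portfolios_def)
  then show "H \<in> strategies (node \<S> S' i) i"
    using assms strategies_later by blast
  fix n S'' assume n: "i \<le> n" and S'': "S'' \<in> node \<S> S' i"
  have "portfolio i (portfolio j V H i S') H n S'' = portfolio j V H n S''"
    using portfolio_split [OF assms(3) n] portfolio_eq [OF H assms(2) S''] by metis
  moreover have "S'' \<in> node \<S> S j"
    using S'' node_subset assms by blast
  ultimately show "0 \<le> portfolio i (portfolio j V H i S') H n S''"
    using assms n by (simp add: nonneg_portfolios_def)
qed

lemma liminf_portfolio_later:
  assumes "H \<in> strategies (node \<S> S j) j" "S' \<in> node \<S> S j" "j \<le> i" "S'' \<in> node \<S> S' i"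
  shows "liminf_portfolio i (portfolio j V H i S') H S'' = liminf_portfolio j V H S''"
  unfolding liminf_portfolio_def
proof (rule Liminf_eq)
  show "\<forall>\<^sub>F n in sequentially. ereal (portfolio i (portfolio j V H i S') H n S'')
      = ereal (portfolio j V H n S'')"
    using eventually_ge_at_top [of i]
  proof eventually_elim
    case (elim n)
    then show ?case
      using portfolio_split [OF assms(3) elim] portfolio_eq [OF assms(1,2,4)] by metis
  qed
qed

lemma nonneg_portfolios_scale:
  "nonneg_portfolios N j V H \<Longrightarrow> 0 \<le> c \<Longrightarrow> nonneg_portfolios N j (c * V) (\<lambda>i S. c * H i S)"
  by (simp add: nonneg_portfolios_def strategies_scale portfolio_scale)

lemma liminf_portfolio_scale:
  "0 \<le> c \<Longrightarrow> liminf_portfolio j (c * V) (\<lambda>i S. c * H i S) S = ereal c * liminf_portfolio j V H S"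
  unfolding liminf_portfolio_def portfolio_scale
  by (simp add: Liminf_ereal_mult_left flip: times_ereal.simps(1))

lemma nonneg_portfolios_stopped:
  "nonneg_portfolios N j V H \<Longrightarrow> j \<le> i \<Longrightarrow>
    nonneg_portfolios N j V (\<lambda>k S. if k < i then H k S else 0)"
  by (simp add: nonneg_portfolios_def strategies_stopped portfolio_stopped)

lemma liminf_portfolio_stopped:
  "liminf_portfolio j V (\<lambda>k S. if k < i then H k S else 0) S = ereal (portfolio j V H i S)"
proof -
  have "ereal (portfolio j V H (min n i) S) = ereal (portfolio j V H i S)" if "i \<le> n" for n
    using that by (simp add: min_absorb2)
  then have "\<forall>\<^sub>F n in sequentially. ereal (portfolio j V H (min n i) S) = ereal (portfolio j V H i S)"
    using eventually_sequentially by blast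
  then have "liminf (\<lambda>n. ereal (portfolio j V H (min n i) S)) = liminf (\<lambda>n. ereal (portfolio j V H i S))"
    by (rule Liminf_eq)
  then show ?thesis
    by (simp add: liminf_portfolio_def portfolio_stopped Liminf_const)
qed

lemma nonneg_portfolios_cost:
  assumes "nonneg_portfolios N j V H" "N \<noteq> {}"
  shows "0 \<le> V"
proof -
  obtain S where "S \<in> N" using assms by blast
  then have "0 \<le> portfolio j V H j S"
    using assms by (simp add: nonneg_portfolios_def)
  then show ?thesis
    by (simp add: portfolio_def)
qed

lemma liminf_portfolio_nonneg:
  assumes "nonneg_portfolios N j V H" "S \<in> N"
  shows "0 \<le> liminf_portfolio j V H S"
proof -
  have "0 \<le> ereal (portfolio j V H n S)" if "j \<le> n" for n
    using assms that by (simp add: nonneg_portfolios_def)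
  then have "\<forall>\<^sub>F n in sequentially. 0 \<le> ereal (portfolio j V H n S)"
    using eventually_sequentially by blast
  then show ?thesis
    unfolding liminf_portfolio_def by (rule Liminf_bounded)
qed

section \<open>Negligible sets\<close>

text \<open>On a nonempty \<S> at time 0 this is nullity of a subset of \<S>. The payoff is asked to
  be infinite rather than at least 1 because an infinite payoff survives scaling by a positive
  factor and dominates any target function when it is added to a hedge.\<close>

definition negligible :: "traj set \<Rightarrow> nat \<Rightarrow> traj set \<Rightarrow> bool" where
  "negligible N j E \<longleftrightarrow> (\<forall>\<epsilon>>0. \<exists>V H. (\<forall>m. nonneg_portfolios N j (V m) (H m)) \<and>
     (\<Sum>m. ereal (V m)) \<le> ereal \<epsilon> \<and> (\<forall>S\<in>N \<inter> E. (\<Sum>m. liminf_portfolio j (V m) (H m) S) = \<infinity>))"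

lemma negligibleD:
  assumes "negligible N j E" "0 < \<epsilon>"
  shows "\<exists>V H. (\<forall>m. nonneg_portfolios N j (V m) (H m)) \<and> (\<Sum>m. ereal (V m)) \<le> ereal \<epsilon> \<and>
    (\<forall>S\<in>N \<inter> E. (\<Sum>m. liminf_portfolio j (V m) (H m) S) = \<infinity>)"
  using assms unfolding negligible_def by presburger

lemma negligible_mono:
  assumes "negligible N j E" "N \<inter> E' \<subseteq> E"
  shows "negligible N j E'"
  unfolding negligible_def
proof (intro allI impI)
  fix \<epsilon> :: real assume "0 < \<epsilon>"
  obtain V H where "\<forall>m. nonneg_portfolios N j (V m) (H m)" "(\<Sum>m. ereal (V m)) \<le> ereal \<epsilon>"
    "\<forall>S\<in>N \<inter> E. (\<Sum>m. liminf_portfolio j (V m) (H m) S) = \<infinity>"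
    using negligibleD [OF assms(1) \<open>0 < \<epsilon>\<close>] by (elim exE conjE) (rule that)
  then show "\<exists>V H. (\<forall>m. nonneg_portfolios N j (V m) (H m)) \<and> (\<Sum>m. ereal (V m)) \<le> ereal \<epsilon> \<and>
      (\<forall>S\<in>N \<inter> E'. (\<Sum>m. liminf_portfolio j (V m) (H m) S) = \<infinity>)"
    using assms(2) by (intro exI [of _ V] exI [of _ H]) blast
qed

text \<open>Countably many families are merged into one by pairing the indices. Costs and payoffs
  are nonnegative on the nonempty \<open>N\<close>, so both double series can be regrouped
  freely.\<close>

lemma countable_families:
  fixes c :: "nat \<Rightarrow> real"
  assumes "N \<noteq> {}" and nonneg: "\<And>k m. nonneg_portfolios N j (V k m) (H k m)"
    and cost: "\<And>k. (\<Sum>m. ereal (V k m)) \<le> ereal (c k)" and c: "c sums C"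
  obtains V' H' where "\<forall>m. nonneg_portfolios N j (V' m) (H' m)" "(\<Sum>m. ereal (V' m)) \<le> ereal C"
    "\<forall>S\<in>N. (\<Sum>m. liminf_portfolio j (V' m) (H' m) S)
       = (\<Sum>k m. liminf_portfolio j (V k m) (H k m) S)"
proof
  define V' where "V' i = V (fst (prod_decode i)) (snd (prod_decode i))" for i
  define H' where "H' i = H (fst (prod_decode i)) (snd (prod_decode i))" for i
  have V: "0 \<le> V k m" for k m
    using nonneg_portfolios_cost [OF nonneg \<open>N \<noteq> {}\<close>] .
  show "\<forall>m. nonneg_portfolios N j (V' m) (H' m)"
    by (simp add: V'_def H'_def nonneg)
  have "(\<Sum>m. ereal (V' m)) = (\<Sum>k m. ereal (V k m))"
    using suminf_ereal_2dimen [of "\<lambda>p. ereal (V (fst p) (snd p))"] V by (simp add: V'_def)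
  also have "\<dots> \<le> (\<Sum>k. ereal (c k))"
    by (intro suminf_le_pos cost suminf_0_le) (simp add: V)
  also have "\<dots> = ereal C"
    using c by (rule sums_suminf_ereal)
  finally show "(\<Sum>m. ereal (V' m)) \<le> ereal C" .
  show "\<forall>S\<in>N. (\<Sum>m. liminf_portfolio j (V' m) (H' m) S)
       = (\<Sum>k m. liminf_portfolio j (V k m) (H k m) S)"
  proof
    fix S assume "S \<in> N"
    then show "(\<Sum>m. liminf_portfolio j (V' m) (H' m) S)
       = (\<Sum>k m. liminf_portfolio j (V k m) (H k m) S)"
      using suminf_ereal_2dimen [of "\<lambda>p. liminf_portfolio j (V (fst p) (snd p)) (H (fst p) (snd p)) S"]
        liminf_portfolio_nonneg [OF nonneg] by (simp add: V'_def H'_def)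
  qed
qed

lemma sums_geometric_cost: "(\<lambda>k. \<epsilon> * (1/2) ^ Suc k) sums (\<epsilon> :: real)"
  using sums_mult [OF power_half_series, of \<epsilon>] by simp

text \<open>The \<open>k\<close>-th set is covered at cost \<epsilon> / 2^(k+1); in the merged
  family a single infinite summand suffices.\<close>

lemma negligible_UN:
  assumes "N \<noteq> {}" "\<And>k :: nat. negligible N j (E k)"
  shows "negligible N j (\<Union>k. E k)"
  unfolding negligible_def
proof (intro allI impI)
  fix \<epsilon> :: real assume "0 < \<epsilon>"
  then have "\<forall>k. \<exists>V H. (\<forall>m. nonneg_portfolios N j (V m) (H m)) \<and>
      (\<Sum>m. ereal (V m)) \<le> ereal (\<epsilon> * (1/2) ^ Suc k) \<and>
      (\<forall>S\<in>N \<inter> E k. (\<Sum>m. liminf_portfolio j (V m) (H m) S) = \<infinity>)"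
    by (intro allI negligibleD assms) simp
  then obtain V H where VH: "\<forall>k. (\<forall>m. nonneg_portfolios N j (V k m) (H k m)) \<and>
      (\<Sum>m. ereal (V k m)) \<le> ereal (\<epsilon> * (1/2) ^ Suc k) \<and>
      (\<forall>S\<in>N \<inter> E k. (\<Sum>m. liminf_portfolio j (V k m) (H k m) S) = \<infinity>)"
    unfolding choice_iff by (elim exE) (rule that)
  then have np: "\<And>k m. nonneg_portfolios N j (V k m) (H k m)"
    and cost: "\<And>k. (\<Sum>m. ereal (V k m)) \<le> ereal (\<epsilon> * (1/2) ^ Suc k)"
    by blast+
  obtain V' H' where V'H': "\<forall>m. nonneg_portfolios N j (V' m) (H' m)" "(\<Sum>m. ereal (V' m)) \<le> ereal \<epsilon>"
    "\<forall>S\<in>N. (\<Sum>m. liminf_portfolio j (V' m) (H' m) S)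
       = (\<Sum>k m. liminf_portfolio j (V k m) (H k m) S)"
    by (rule countable_families [OF assms(1) np cost sums_geometric_cost]) (rule that)
  have "(\<Sum>m. liminf_portfolio j (V' m) (H' m) S) = \<infinity>" if S: "S \<in> N \<inter> (\<Union>k. E k)" for S
  proof -
    obtain k where k: "S \<in> E k" using S by blast
    have "(\<Sum>m. liminf_portfolio j (V k m) (H k m) S) = \<infinity>"
      using VH k S by blast
    then have "(\<Sum>k m. liminf_portfolio j (V k m) (H k m) S) = \<infinity>"
      using suminf_PInfty [of "\<lambda>k. \<Sum>m. liminf_portfolio j (V k m) (H k m) S" k] S
      by (auto intro!: suminf_0_le liminf_portfolio_nonneg [OF np])
    then show ?thesis
      using V'H'(3) S by simp
  qed
  then show "\<exists>V H. (\<forall>m. nonneg_portfolios N j (V m) (H m)) \<and> (\<Sum>m. ereal (V m)) \<le> ereal \<epsilon> \<and>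
      (\<forall>S\<in>N \<inter> (\<Union>k. E k). (\<Sum>m. liminf_portfolio j (V m) (H m) S) = \<infinity>)"
    using V'H'(1,2) by blast
qed

lemma negligible_Un:
  assumes "N \<noteq> {}" "negligible N j A" "negligible N j B"
  shows "negligible N j (A \<union> B)"
proof -
  have "negligible N j (\<Union>k::nat. if k = 0 then A else B)"
    using assms by (intro negligible_UN) auto
  moreover have "A \<union> B \<subseteq> (\<Union>k::nat. if k = 0 then A else B)"
    by (auto split: if_splits intro: exI [of _ 0] exI [of _ "1::nat"])
  ultimately show ?thesis
    using negligible_mono by blast
qed

text \<open>Covers of the indicator with geometrically decreasing costs are added up: each pays at
  least 1 on \<open>E\<close>, so together they pay infinitely much there.\<close>

lemma null_set_imp_negligible:
  assumes "\<S> \<noteq> {}" "null_set \<S> E"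
  shows "negligible \<S> 0 E"
  unfolding negligible_def
proof (intro allI impI)
  fix \<epsilon> :: real assume "0 < \<epsilon>"
  have "\<forall>k. \<exists>V H. (\<forall>m. nonneg_portfolios \<S> 0 (V m) (H m)) \<and>
      (\<Sum>m. ereal (V m)) \<le> ereal (\<epsilon> * (1/2) ^ Suc k) \<and>
      (\<forall>S\<in>\<S>. indicator E S \<le> (\<Sum>m. liminf_portfolio 0 (V m) (H m) S))"
  proof
    fix k
    have "I_node \<S> 0 (indicator E) < ereal (\<epsilon> * (1/2) ^ Suc k)"
      using assms \<open>0 < \<epsilon>\<close> by (simp add: null_set_def I_bar_def)
    then show "\<exists>V H. (\<forall>m. nonneg_portfolios \<S> 0 (V m) (H m)) \<and>
      (\<Sum>m. ereal (V m)) \<le> ereal (\<epsilon> * (1/2) ^ Suc k) \<and>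
      (\<forall>S\<in>\<S>. indicator E S \<le> (\<Sum>m. liminf_portfolio 0 (V m) (H m) S))"
      unfolding I_node_def Inf_less_iff by (auto intro: less_imp_le)
  qed
  then obtain V H where VH: "\<forall>k. (\<forall>m. nonneg_portfolios \<S> 0 (V k m) (H k m)) \<and>
      (\<Sum>m. ereal (V k m)) \<le> ereal (\<epsilon> * (1/2) ^ Suc k) \<and>
      (\<forall>S\<in>\<S>. indicator E S \<le> (\<Sum>m. liminf_portfolio 0 (V k m) (H k m) S))"
    unfolding choice_iff by (elim exE) (rule that)
  then have np: "\<And>k m. nonneg_portfolios \<S> 0 (V k m) (H k m)"
    and cost: "\<And>k. (\<Sum>m. ereal (V k m)) \<le> ereal (\<epsilon> * (1/2) ^ Suc k)"
    by blast+
  obtain V' H' where V'H': "\<forall>m. nonneg_portfolios \<S> 0 (V' m) (H' m)" "(\<Sum>m. ereal (V' m)) \<le> ereal \<epsilon>"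
    "\<forall>S\<in>\<S>. (\<Sum>m. liminf_portfolio 0 (V' m) (H' m) S)
       = (\<Sum>k m. liminf_portfolio 0 (V k m) (H k m) S)"
    by (rule countable_families [OF assms(1) np cost sums_geometric_cost]) (rule that)
  have "(\<Sum>m. liminf_portfolio 0 (V' m) (H' m) S) = \<infinity>" if S: "S \<in> \<S> \<inter> E" for S
  proof -
    have "indicator E S \<le> (\<Sum>m. liminf_portfolio 0 (V k m) (H k m) S)" for k
      using VH S by blast
    then have "1 \<le> (\<Sum>m. liminf_portfolio 0 (V k m) (H k m) S)" for k
      using S by (simp add: indicator_def)
    then have "(\<Sum>k::nat. 1::ereal) \<le> (\<Sum>k m. liminf_portfolio 0 (V k m) (H k m) S)"
      by (intro suminf_le_pos) auto
    moreover have "(\<Sum>k::nat. 1::ereal) = \<infinity>"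
      using suminf_const_ereal [of 1] by (simp add: one_ereal_def)
    ultimately show ?thesis
      using V'H'(3) S by simp
  qed
  then show "\<exists>V H. (\<forall>m. nonneg_portfolios \<S> 0 (V m) (H m)) \<and> (\<Sum>m. ereal (V m)) \<le> ereal \<epsilon> \<and>
      (\<forall>S\<in>\<S> \<inter> E. (\<Sum>m. liminf_portfolio 0 (V m) (H m) S) = \<infinity>)"
    using V'H'(1,2) by blast
qed

lemma negligible_imp_null_set:
  assumes "\<S> \<noteq> {}" "E \<subseteq> \<S>" "negligible \<S> 0 E"
  shows "null_set \<S> E"
proof -
  have "0 \<le> I_node \<S> 0 (indicator E)"
    unfolding I_node_def
    by (rule Inf_greatest) (auto intro!: suminf_0_le nonneg_portfolios_cost assms)
  moreover have "I_node \<S> 0 (indicator E) \<le> 0 + ereal \<epsilon>" if "0 < \<epsilon>" for \<epsilon>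
  proof -
    obtain V H where VH: "\<forall>m. nonneg_portfolios \<S> 0 (V m) (H m)" "(\<Sum>m. ereal (V m)) \<le> ereal \<epsilon>"
      "\<forall>S\<in>\<S> \<inter> E. (\<Sum>m. liminf_portfolio 0 (V m) (H m) S) = \<infinity>"
      using negligibleD [OF assms(3) \<open>0 < \<epsilon>\<close>] by (elim exE conjE) (rule that)
    have "indicator E S \<le> (\<Sum>m. liminf_portfolio 0 (V m) (H m) S)" if "S \<in> \<S>" for S
      using VH(3) that suminf_0_le liminf_portfolio_nonneg [OF VH(1)[rule_format] that]
      by (cases "S \<in> E") auto
    then have "I_node \<S> 0 (indicator E) \<le> (\<Sum>m. ereal (V m))"
      unfolding I_node_def using VH(1) by (intro Inf_lower) blast
    then show ?thesis
      using VH(2) by simp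
  qed
  ultimately show ?thesis
    using assms ereal_le_epsilon2 [of "I_node \<S> 0 (indicator E)" 0]
    unfolding null_set_def I_bar_def by (auto intro: antisym)
qed

text \<open>
  A family that is infinite on \<open>E\<close> stays infinite on \<open>E\<close> when it is restarted at a later node; its
  cost there is the value of the family at the node, which can be scaled down as soon as it is
  finite. The family stopped at that time witnesses that the value is finite off a negligible set.
\<close>

lemma negligible_later:
  assumes "trajectory_set s0 \<S>" "\<S> \<noteq> {}" "negligible \<S> 0 E"
  shows "negligible \<S> 0 {S \<in> \<S>. \<exists>j. \<not> negligible (node \<S> S j) j E}"
proof -
  have "negligible \<S> 0 {S \<in> \<S>. \<not> negligible (node \<S> S j) j E}" for j
    unfolding negligible_def [of \<S>]
  proof (intro allI impI)
    fix \<epsilon> :: real assume "0 < \<epsilon>"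
    obtain V H where VH: "\<forall>m. nonneg_portfolios \<S> 0 (V m) (H m)"
      "(\<Sum>m. ereal (V m)) \<le> ereal \<epsilon>"
      "\<forall>S\<in>\<S> \<inter> E. (\<Sum>m. liminf_portfolio 0 (V m) (H m) S) = \<infinity>"
      using negligibleD [OF assms(3) \<open>0 < \<epsilon>\<close>] by (elim exE conjE) (rule that)
    let ?H = "\<lambda>m k S. if k < j then H m k S else 0"
    have "(\<Sum>m. liminf_portfolio 0 (V m) (?H m) S) = \<infinity>"
      if S: "S \<in> \<S>" and bad: "\<not> negligible (node \<S> S j) j E" for S
    proof (rule ccontr)
      define v where "v m = portfolio 0 (V m) (H m) j S" for m
      have n0: "node \<S> S 0 = \<S>"
        using node_0 assms(1) S by blast
      have VH0: "nonneg_portfolios (node \<S> S 0) 0 (V m) (H m)" for m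
        using VH(1) n0 by simp
      have H0: "H m \<in> strategies (node \<S> S 0) 0" for m
        using VH0 by (simp add: nonneg_portfolios_def)
      have S0: "S \<in> node \<S> S 0"
        using S n0 by simp
      have np: "nonneg_portfolios (node \<S> S j) j (v m) (H m)" for m
        unfolding v_def using nonneg_portfolios_later [OF VH0 S0] by simp
      have v: "0 \<le> v m" for m
        using nonneg_portfolios_cost [OF np] self_in_node [OF S] by blast
      assume "(\<Sum>m. liminf_portfolio 0 (V m) (?H m) S) \<noteq> \<infinity>"
      then have "(\<Sum>m. ereal (v m)) \<noteq> \<infinity>"
        by (simp add: liminf_portfolio_stopped v_def)
      then have sv: "summable v"
        using summable_ereal v by blast
      have "negligible (node \<S> S j) j E"
        unfolding negligible_def
      proof (intro allI impI)
        fix \<delta> :: real assume "0 < \<delta>"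
        \<comment> \<open>The scaling brings the cost \<open>suminf v\<close> below \<delta>; the
          added 1 keeps the denominator positive when that cost is 0.\<close>
        define c where "c = \<delta> / (suminf v + 1)"
        have sv0: "0 \<le> suminf v"
          using suminf_nonneg sv v by blast
        then have c: "0 < c"
          using \<open>0 < \<delta>\<close> by (simp add: c_def)
        show "\<exists>V H. (\<forall>m. nonneg_portfolios (node \<S> S j) j (V m) (H m)) \<and>
          (\<Sum>m. ereal (V m)) \<le> ereal \<delta> \<and>
          (\<forall>S\<in>node \<S> S j \<inter> E. (\<Sum>m. liminf_portfolio j (V m) (H m) S) = \<infinity>)"
        proof (intro exI conjI allI ballI)
          show "nonneg_portfolios (node \<S> S j) j (c * v m) (\<lambda>i S. c * H m i S)" for m
            using nonneg_portfolios_scale [OF np] c by simp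
          have "(\<Sum>m. ereal (c * v m)) = ereal (c * suminf v)"
            using sv by (simp add: suminf_ereal' suminf_mult)
          also have "c * suminf v \<le> \<delta>"
            using \<open>0 < \<delta>\<close> sv0 by (simp add: c_def field_simps)
          finally show "(\<Sum>m. ereal (c * v m)) \<le> ereal \<delta>" by simp
          fix S' assume S': "S' \<in> node \<S> S j \<inter> E"
          have "liminf_portfolio j (c * v m) (\<lambda>i S. c * H m i S) S'
              = ereal c * liminf_portfolio 0 (V m) (H m) S'" for m
            using S' c liminf_portfolio_later [OF H0 S0 _, of j S'] unfolding v_def
            by (simp add: liminf_portfolio_scale)
          then have "(\<Sum>m. liminf_portfolio j (c * v m) (\<lambda>i S. c * H m i S) S')
              = ereal c * (\<Sum>m. liminf_portfolio 0 (V m) (H m) S')"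
            using c S' liminf_portfolio_nonneg [OF VH(1)[rule_format]]
            by (simp add: suminf_cmult_ereal node_def)
          then show "(\<Sum>m. liminf_portfolio j (c * v m) (\<lambda>i S. c * H m i S) S') = \<infinity>"
            using VH(3) S' c by (simp add: node_def)
        qed
      qed
      then show False using bad by blast
    qed
    then show "\<exists>V H. (\<forall>m. nonneg_portfolios \<S> 0 (V m) (H m)) \<and> (\<Sum>m. ereal (V m)) \<le> ereal \<epsilon> \<and>
      (\<forall>S\<in>\<S> \<inter> {S \<in> \<S>. \<not> negligible (node \<S> S j) j E}.
         (\<Sum>m. liminf_portfolio 0 (V m) (H m) S) = \<infinity>)"
      using VH(2) nonneg_portfolios_stopped [OF VH(1)[rule_format]] by (intro exI [of _ V] exI [of _ ?H]) auto
  qed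
  then have "negligible \<S> 0 (\<Union>j. {S \<in> \<S>. \<not> negligible (node \<S> S j) j E})"
    by (rule negligible_UN [OF assms(2)])
  then show ?thesis
    by (rule negligible_mono) blast
qed

section \<open>One-sided nodes\<close>

text \<open>The inequality is weak, so a node at which the price cannot move counts as up and as
  down; a node that is neither has strict moves in both directions.\<close>

definition up_node :: "traj set \<Rightarrow> traj \<Rightarrow> nat \<Rightarrow> bool" where
  "up_node \<S> S i \<longleftrightarrow> (\<forall>S'\<in>node \<S> S i. S' i \<le> S' (Suc i))"

definition down_node :: "traj set \<Rightarrow> traj \<Rightarrow> nat \<Rightarrow> bool" where
  "down_node \<S> S i \<longleftrightarrow> (\<forall>S'\<in>node \<S> S i. S' (Suc i) \<le> S' i)"

text \<open>Trajectories that stay flat at a one-sided node are left out: for them the position held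
  does not matter.\<close>

definition arbitrage_moves :: "traj set \<Rightarrow> traj set" where
  "arbitrage_moves \<S> = {S \<in> \<S>. \<exists>i. S (Suc i) \<noteq> S i \<and> (up_node \<S> S i \<or> down_node \<S> S i)}"

text \<open>
  Trading one share at the one-sided nodes, in the only direction in which the price can move,
  costs nothing and gains at every such move; countably many copies of it gain infinitely much.
\<close>

lemma negligible_arbitrage_moves:
  assumes "trajectory_set s0 \<S>"
  shows "negligible \<S> 0 (arbitrage_moves \<S>)"
  unfolding negligible_def
proof (intro allI impI)
  fix \<epsilon> :: real assume "0 < \<epsilon>"
  define H where "H i S = (if up_node \<S> S i then 1 else if down_node \<S> S i then - 1 else 0 :: real)" for i and S :: traj
  have gain: "0 \<le> H i S * (S (Suc i) - S i)" if "S \<in> \<S>" for i S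
    using self_in_node [OF that, of i] by (auto simp: H_def up_node_def down_node_def)
  have "H \<in> strategies \<S> 0"
  proof (rule strategiesI)
    fix i :: nat and S S' :: traj
    assume "\<And>k. 0 \<le> k \<Longrightarrow> k \<le> i \<Longrightarrow> S k = S' k"
    then have "node \<S> S i = node \<S> S' i"
      by (simp add: node_def)
    then show "H i S = H i S'"
      by (simp add: H_def up_node_def down_node_def)
  qed
  then have np: "nonneg_portfolios \<S> 0 0 H"
    using gain by (simp add: nonneg_portfolios_def portfolio_def sum_nonneg)
  have "(\<Sum>m::nat. liminf_portfolio 0 0 H S) = \<infinity>" if mem: "S \<in> arbitrage_moves \<S>" for S
  proof -
    obtain i where S: "S \<in> \<S>" and i: "S (Suc i) \<noteq> S i" "up_node \<S> S i \<or> down_node \<S> S i"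
      using mem unfolding arbitrage_moves_def by blast
    let ?g = "H i S * (S (Suc i) - S i)"
    have "?g \<noteq> 0"
      using i by (auto simp: H_def)
    then have pos: "0 < ?g"
      using gain [OF S, of i] by linarith
    \<comment> \<open>All increments are nonnegative, so the single gain \<open>?g\<close> bounds
      the accumulated gains from below from time \<open>Suc i\<close> on.\<close>
    have "?g \<le> portfolio 0 0 H n S" if "Suc i \<le> n" for n
      unfolding portfolio_def using that gain [OF S]
      by (simp add: member_le_sum [where f = "\<lambda>i. H i S * (S (Suc i) - S i)"])
    then have "ereal ?g \<le> liminf_portfolio 0 0 H S"
      unfolding liminf_portfolio_def
      by (intro Liminf_bounded eventually_mono [OF eventually_ge_at_top [of "Suc i"]]) simp
    then have "(\<Sum>m::nat. ereal ?g) \<le> (\<Sum>m::nat. liminf_portfolio 0 0 H S)"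
      using pos by (intro suminf_le_pos) auto
    moreover have "(\<Sum>m::nat. ereal ?g) = \<infinity>"
      using suminf_const_ereal [OF pos] .
    ultimately show ?thesis by simp
  qed
  then show "\<exists>V H. (\<forall>m. nonneg_portfolios \<S> 0 (V m) (H m)) \<and> (\<Sum>m. ereal (V m)) \<le> ereal \<epsilon> \<and>
      (\<forall>S\<in>\<S> \<inter> arbitrage_moves \<S>. (\<Sum>m. liminf_portfolio 0 (V m) (H m) S) = \<infinity>)"
    using np \<open>0 < \<epsilon>\<close>
    by (intro exI [of _ "\<lambda>_. 0"] exI [of _ "\<lambda>_. H"]) (auto simp flip: zero_ereal_def)
qed

section \<open>Superhedging over a single time step\<close>

text \<open>
  Property \<open>L\<close> at the successor node turns the superhedge with maturity at infinity into a
  superhedge at time \<open>Suc i\<close>: the shortfall of the first portfolio at that time is covered by the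
  values that the nonnegative portfolios have then.
\<close>

lemma superhedge_next_step:
  fixes g :: "traj \<Rightarrow> real"
  assumes H0: "H0 \<in> strategies (node \<S> S i) i" and "i \<le> n0"
    and np: "\<And>m. nonneg_portfolios (node \<S> S i) i (V m) (H m)"
    and hedge: "\<And>S'. S' \<in> node \<S> S i \<Longrightarrow>
      ereal (g S') \<le> ereal (portfolio i V0 H0 n0 S') + (\<Sum>m. liminf_portfolio i (V m) (H m) S')"
    and S': "S' \<in> node \<S> S i" and L: "L_node (node \<S> S' (Suc i)) (Suc i)"
    and g: "\<And>S''. S'' \<in> node \<S> S' (Suc i) \<Longrightarrow> g S'' = g S'"
  shows "ereal (g S') \<le> ereal (V0 + (if i < n0 then H0 i S' else 0) * (S' (Suc i) - S' i))
    + (\<Sum>m. ereal (portfolio i (V m) (H m) (Suc i) S'))"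
proof -
  \<comment> \<open>Positions are cut off at \<open>n0\<close> so that the maturity can be raised to
    \<open>n\<close>, which is at least \<open>Suc i\<close> even when
    \<open>n0 = i\<close>.\<close>
  define G where "G k S = (if k < n0 then H0 k S else 0)" for k S
  define n where "n = max n0 (Suc i)"
  have G: "G \<in> strategies (node \<S> S i) i"
    unfolding G_def using strategies_stopped [OF H0] .
  have pG: "portfolio i V0 H0 n0 S'' = portfolio i V0 G n S''" for S''
    using portfolio_stopped [of i V0 n0 H0 n S''] by (simp add: G_def [abs_def] n_def)
  define p where "p = portfolio i V0 G (Suc i) S'"
  have "ereal (g S' - p) \<le> (\<Sum>m. ereal (portfolio i (V m) (H m) (Suc i) S'))"
  \<comment> \<open>Property \<open>L\<close> is applied to the reversed positions with capital
    \<open>g S' - p\<close>: by time \<open>n\<close> they yield \<open>g\<close> minus the payoff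
    of the first portfolio, which the hedge bounds by the limits inferior.\<close>
  proof (rule L [unfolded L_node_def, rule_format], intro conjI allI ballI)
    show "(\<lambda>k S. - 1 * G k S) \<in> strategies (node \<S> S' (Suc i)) (Suc i)"
      by (intro strategies_scale strategies_later [OF G S']) simp
    show "Suc i \<le> n" by (simp add: n_def)
    show "nonneg_portfolios (node \<S> S' (Suc i)) (Suc i) (portfolio i (V m) (H m) (Suc i) S') (H m)" for m
      by (rule nonneg_portfolios_later [OF np S']) simp
    fix S'' assume S'': "S'' \<in> node \<S> S' (Suc i)"
    have S''i: "S'' \<in> node \<S> S i"
      using S'' S' node_subset [of S' \<S> S i "Suc i"] by auto
    have "portfolio i V0 G n S'' = portfolio (Suc i) p G n S''"
      using portfolio_split [of i "Suc i" n V0 G S''] portfolio_eq [OF G S' S'']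
      by (simp add: p_def n_def)
    then have "portfolio (Suc i) (g S' - p) (\<lambda>k S. - 1 * G k S) n S'' = g S'' - portfolio i V0 H0 n0 S''"
      using g [OF S''] pG by (simp add: portfolio_def sum_negf)
    moreover have "liminf_portfolio (Suc i) (portfolio i (V m) (H m) (Suc i) S') (H m) S''
        = liminf_portfolio i (V m) (H m) S''" for m
      using np by (intro liminf_portfolio_later [OF _ S' _ S'']) (auto simp: nonneg_portfolios_def)
    moreover have "ereal (a - b) \<le> x" if "ereal a \<le> ereal b + x" for a b x
      using that by (cases x) auto
    ultimately show "ereal (portfolio (Suc i) (g S' - p) (\<lambda>k S. - 1 * G k S) n S'')
        \<le> (\<Sum>m. liminf_portfolio (Suc i) (portfolio i (V m) (H m) (Suc i) S') (H m) S'')"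
      using hedge [OF S''i] by simp
  qed
  moreover have "p = V0 + G i S' * (S' (Suc i) - S' i)"
    by (simp add: p_def portfolio_def)
  moreover have "ereal a \<le> ereal b + x" if "ereal (a - b) \<le> x" for a b x
    using that by (cases x) auto
  ultimately show ?thesis
    by (simp add: G_def)
qed

text \<open>
  At a node with moves in both directions, nonnegativity of the portfolios bounds the positions
  \<open>H m i S\<close> by multiples of the costs \<open>V m\<close>, so that they add up to a single position.
\<close>

lemma single_position:
  fixes f :: "nat \<Rightarrow> traj \<Rightarrow> real"
  assumes S: "S \<in> \<S>" and "0 < \<epsilon>"
    and f: "nonanticipative \<S> (\<lambda>j S. ereal (f j S))"
    and super: "sigma_bar \<S> (enat i) (\<lambda>S. ereal (f (Suc i) S)) S \<le> ereal (f i S)"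
  shows "\<exists>h. \<forall>S'\<in>node \<S> S i. L_node (node \<S> S' (Suc i)) (Suc i) \<longrightarrow> S' \<notin> arbitrage_moves \<S> \<longrightarrow>
    f (Suc i) S' \<le> f i S' + \<epsilon> + h * (S' (Suc i) - S' i)"
proof -
  have f_eq: "f j S2 = f j S1" if "S1 \<in> \<S>" "S2 \<in> node \<S> S1 j" for j S1 S2
    using f that by (auto simp: nonanticipative_def)
  \<comment> \<open>The room \<epsilon> makes the inequality strict, so some actual hedge costs less
    than the right-hand side; in particular its total cost is finite.\<close>
  have "sigma_node (node \<S> S i) i (\<lambda>S. ereal (f (Suc i) S)) < ereal (f i S + \<epsilon>)"
    using super \<open>0 < \<epsilon>\<close> by (simp add: sigma_bar_def) (meson ereal_less_eq(3) le_less_trans less_add_same_cancel1 less_ereal.simps(1))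
  then obtain V0 H0 n0 V H where H0: "H0 \<in> strategies (node \<S> S i) i" and n0: "i \<le> n0"
    and np: "\<And>m. nonneg_portfolios (node \<S> S i) i (V m) (H m)"
    and hedge: "\<And>S'. S' \<in> node \<S> S i \<Longrightarrow> ereal (f (Suc i) S')
      \<le> ereal (portfolio i V0 H0 n0 S') + (\<Sum>m. liminf_portfolio i (V m) (H m) S')"
    and cost: "ereal V0 + (\<Sum>m. ereal (V m)) < ereal (f i S + \<epsilon>)"
    unfolding sigma_node_def Inf_less_iff by blast
  have V: "0 \<le> V m" for m
    using nonneg_portfolios_cost [OF np] self_in_node [OF S] by blast
  have sV: "summable V"
    using cost V by (intro summable_ereal) auto
  have cost': "V0 + suminf V < f i S + \<epsilon>"
    using cost suminf_ereal' [OF sV] by simp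
  define h0 where "h0 = (if i < n0 then H0 i S else 0)"
  define h where "h m = H m i S" for m
  have Hm: "H m \<in> strategies (node \<S> S i) i" for m
    using np by (simp add: nonneg_portfolios_def)
  have val: "portfolio i (V m) (H m) (Suc i) S' = V m + h m * (S' (Suc i) - S' i)"
    if "S' \<in> node \<S> S i" for m S'
    using strategies_eq [OF Hm self_in_node [OF S] that] by (simp add: portfolio_def h_def)
  have val_nonneg: "0 \<le> V m + h m * (S' (Suc i) - S' i)" if "S' \<in> node \<S> S i" for m S'
    using np [of m] val [OF that, of m] that unfolding nonneg_portfolios_def by (metis le_Suc_eq order_refl)
  have step: "ereal (f (Suc i) S') \<le> ereal (V0 + h0 * (S' (Suc i) - S' i))
      + (\<Sum>m. ereal (V m + h m * (S' (Suc i) - S' i)))"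
    if S': "S' \<in> node \<S> S i" and L: "L_node (node \<S> S' (Suc i)) (Suc i)" for S'
  proof -
    have "S' \<in> \<S>" using S' by (simp add: node_def)
    then have "f (Suc i) S'' = f (Suc i) S'" if "S'' \<in> node \<S> S' (Suc i)" for S''
      using f_eq that by blast
    note superhedge_next_step [where g = "f (Suc i)", OF H0 n0 np hedge S' L this]
    moreover have "(if i < n0 then H0 i S' else 0) = h0"
      using strategies_eq [OF H0 self_in_node [OF S] S'] by (simp add: h0_def)
    ultimately show ?thesis
      by (simp only: val [OF S'])
  qed
  show ?thesis
  proof (cases "up_node \<S> S i \<or> down_node \<S> S i")
    case True
    \<comment> \<open>Off \<open>arbitrage_moves\<close> the price does not move here, so every
      position works; 0 is chosen.\<close>
    have "f (Suc i) S' \<le> f i S' + \<epsilon> + 0 * (S' (Suc i) - S' i)"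
      if S': "S' \<in> node \<S> S i" and L: "L_node (node \<S> S' (Suc i)) (Suc i)" and "S' \<notin> arbitrage_moves \<S>" for S'
    proof -
      have "S' (Suc i) = S' i"
      proof (rule ccontr)
        assume "S' (Suc i) \<noteq> S' i"
        moreover have "up_node \<S> S' i \<or> down_node \<S> S' i"
          using True by (simp add: up_node_def down_node_def node_eq [OF S'])
        moreover have "S' \<in> \<S>"
          using S' by (simp add: node_def)
        ultimately show False
          using \<open>S' \<notin> arbitrage_moves \<S>\<close> unfolding arbitrage_moves_def by blast
      qed
      then have "f (Suc i) S' \<le> V0 + suminf V"
        using step [OF S' L] suminf_ereal' [OF sV] by simp
      then show ?thesis
        using cost' f_eq [OF S S'] by simp
    qed
    then show ?thesis by blast
  next
    case False
    then obtain S1 S2 where S1: "S1 \<in> node \<S> S i" "S1 i < S1 (Suc i)"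
      and S2: "S2 \<in> node \<S> S i" "S2 (Suc i) < S2 i"
      unfolding up_node_def down_node_def by (meson not_le)
    define d1 d2 where "d1 = S1 (Suc i) - S1 i" and "d2 = S2 i - S2 (Suc i)"
    have d: "0 < d1" "0 < d2"
      using S1 S2 by (auto simp: d1_def d2_def)
    \<comment> \<open>Nonnegativity after the up move \<open>d1\<close> bounds \<open>h m\<close>
      from below, after the down move \<open>d2\<close> from above.\<close>
    have "\<bar>h m\<bar> \<le> V m * (1 / d1 + 1 / d2)" for m
    proof -
      have "0 \<le> V m + h m * d1" "0 \<le> V m + h m * - d2"
        using val_nonneg [OF S1(1), of m] val_nonneg [OF S2(1), of m] by (auto simp: d1_def d2_def)
      then have "- (V m / d1) \<le> h m" "h m \<le> V m / d2"
        using d by (auto simp: field_simps)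
      moreover have "0 \<le> V m / d1" "0 \<le> V m / d2"
        using d V by auto
      ultimately show ?thesis
        by (auto simp: abs_if distrib_left)
    qed
    then have sh: "summable h"
      by (intro summable_comparison_test' [OF summable_mult2 [OF sV], of 0]) simp
    have "f (Suc i) S' \<le> f i S' + \<epsilon> + (h0 + suminf h) * (S' (Suc i) - S' i)"
      if S': "S' \<in> node \<S> S i" and L: "L_node (node \<S> S' (Suc i)) (Suc i)" for S'
    proof -
      let ?d = "S' (Suc i) - S' i"
      \<comment> \<open>Costs and positions converge separately, so the countable family collapses
        to one affine function of the price move.\<close>
      have "(\<lambda>m. V m + h m * ?d) sums (suminf V + suminf h * ?d)"
        using sV sh by (intro sums_add sums_mult2 summable_sums)
      then have "f (Suc i) S' \<le> (V0 + h0 * ?d) + (suminf V + suminf h * ?d)"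
        using step [OF S' L] by (simp add: sums_suminf_ereal)
      then show ?thesis
        using cost' f_eq [OF S S'] by (simp add: distrib_right)
    qed
    then show ?thesis by blast
  qed
qed

section \<open>Stopping times and the telescoping argument\<close>

text \<open>Agreement up to time \<open>i\<close> includes agreement up to \<tau>, so whether
  stopping has occurred by time \<open>i\<close> is decided at the node.\<close>

lemma stopping_time_eq:
  assumes "stopping_time \<S> \<tau>" "S \<in> \<S>" "S' \<in> node \<S> S i" "\<tau> S \<le> enat i"
  shows "\<tau> S' = \<tau> S"
proof -
  have "S k = S' k" if "enat k \<le> \<tau> S" for k
  proof -
    have "enat k \<le> enat i"
      using that assms(4) by (rule order_trans)
    then show ?thesis
      using node_agree [OF assms(3)] by simp
  qed
  moreover have "S' \<in> \<S>"
    using assms(3) by (simp add: node_def)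
  ultimately have "\<tau> S = \<tau> S'"
    using assms(2) by (intro assms(1) [unfolded stopping_time_def, rule_format])
  then show ?thesis ..
qed

theorem theorem4p4:
  fixes s0 :: real and \<S> :: "traj set"
    and f :: "nat \<Rightarrow> traj \<Rightarrow> real"
    and \<rho> \<tau> :: "traj \<Rightarrow> enat" and C :: nat
    and f\<^sub>\<rho> f\<^sub>\<tau> :: "traj \<Rightarrow> ereal"
  assumes "trajectory_set s0 \<S>"
    and "L_ae \<S>"
    and "supermartingale \<S> (\<lambda>j S. ereal (f j S))"
    and "stopping_time \<S> \<rho>" and "stopping_time \<S> \<tau>"
    and "ae \<S> (\<lambda>S. \<rho> S \<le> \<tau> S)"
    and "ae \<S> (\<lambda>S. \<tau> S \<le> enat C)"
    and "is_stopped \<S> (\<lambda>j S. ereal (f j S)) \<rho> f\<^sub>\<rho>"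
    and "is_stopped \<S> (\<lambda>j S. ereal (f j S)) \<tau> f\<^sub>\<tau>"
  shows "ae \<S> (\<lambda>S. sigma_bar_stop \<S> \<rho> f\<^sub>\<tau> S \<le> f\<^sub>\<rho> S)"
proof (cases "\<S> = {}")
  \<comment> \<open>Costs are unconstrained when there are no trajectories, so the null set has to
    come from a hypothesis.\<close>
  case True
  then show ?thesis
    using assms(6) by (auto simp: ae_def)
next
  case False
  have f: "nonanticipative \<S> (\<lambda>j S. ereal (f j S))"
    using assms(3) by (simp add: supermartingale_def)
  then have f_eq: "f j S2 = f j S1" if "S1 \<in> \<S>" "S2 \<in> node \<S> S1 j" for j S1 S2
    using that by (auto simp: nonanticipative_def)
  define EL where "EL = {S\<in>\<S>. \<exists>j. \<not> L_node (node \<S> S j) j}"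
  have "\<forall>i. \<exists>E. null_set \<S> E \<and>
      (\<forall>S\<in>\<S> - E. sigma_bar \<S> (enat i) (\<lambda>S. ereal (f (Suc i) S)) S \<le> ereal (f i S))"
    using assms(3) by (simp add: supermartingale_def ae_def)
  then obtain E where E: "\<And>i. null_set \<S> (E i)"
    "\<And>i S. S \<in> \<S> \<Longrightarrow> S \<notin> E i \<Longrightarrow> sigma_bar \<S> (enat i) (\<lambda>S. ereal (f (Suc i) S)) S \<le> ereal (f i S)"
    by (metis DiffI)
  obtain E\<^sub>\<rho> where E\<^sub>\<rho>: "null_set \<S> E\<^sub>\<rho>" "\<And>S. S \<in> \<S> \<Longrightarrow> S \<notin> E\<^sub>\<rho> \<Longrightarrow> \<rho> S \<le> \<tau> S"
    using assms(6) by (auto simp: ae_def)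
  obtain E\<^sub>\<tau> where E\<^sub>\<tau>: "null_set \<S> E\<^sub>\<tau>" "\<And>S. S \<in> \<S> \<Longrightarrow> S \<notin> E\<^sub>\<tau> \<Longrightarrow> \<tau> S \<le> enat C"
    using assms(7) by (auto simp: ae_def)
  define B where "B = arbitrage_moves \<S> \<union> EL \<union> (\<Union>i. E i) \<union> E\<^sub>\<rho> \<union> E\<^sub>\<tau>"
  \<comment> \<open>From a trajectory outside \<open>D\<close>, every node along it sees
    \<open>B\<close> as negligible; trajectories branching off need only be compared with
    \<open>B\<close>.\<close>
  define D where "D = {S \<in> \<S>. \<exists>j. \<not> negligible (node \<S> S j) j B}"
  have "null_set \<S> EL"
    using assms(2) by (simp add: L_ae_def EL_def)
  then have B: "negligible \<S> 0 B"
    unfolding B_def using E E\<^sub>\<rho> E\<^sub>\<tau> False assms(1)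
    by (intro negligible_Un negligible_UN negligible_arbitrage_moves null_set_imp_negligible) auto
  have "B \<union> D \<subseteq> \<S>"
    using E E\<^sub>\<rho> E\<^sub>\<tau> unfolding B_def D_def EL_def arbitrage_moves_def null_set_def by blast
  moreover have "negligible \<S> 0 (B \<union> D)"
    unfolding D_def using negligible_Un [OF False B negligible_later [OF assms(1) False B]] .
  ultimately have null: "null_set \<S> (B \<union> D)"
    using negligible_imp_null_set False by blast
  have "sigma_bar_stop \<S> \<rho> f\<^sub>\<tau> S \<le> f\<^sub>\<rho> S" if S: "S \<in> \<S>" "S \<notin> B" "S \<notin> D" for S
  proof -
    have ord: "\<rho> S' \<le> \<tau> S'" "\<tau> S' \<le> enat C" if "S' \<in> \<S>" "S' \<notin> B" for S'
      using that E\<^sub>\<rho>(2) E\<^sub>\<tau>(2) unfolding B_def by auto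
    have "\<rho> S \<le> enat C"
      using ord [OF S(1,2)] by order
    then obtain j where j: "\<rho> S = enat j" "j \<le> C"
      by (cases "\<rho> S") auto
    have "sigma_node (node \<S> S j) j f\<^sub>\<tau> \<le> ereal (f j S) + ereal e" if "0 < e" for e
    proof -
      \<comment> \<open>The error \<open>e\<close> is split into \<open>C\<close> shares for the
        time steps and one for covering \<open>B\<close>.\<close>
      define \<epsilon> where "\<epsilon> = e / (real C + 1)"
      have \<epsilon>: "0 < \<epsilon>" "C * \<epsilon> + \<epsilon> = e"
      proof -
        have "\<epsilon> * (real C + 1) = e"
          unfolding \<epsilon>_def by (simp add: add_pos_nonneg)
        then show "C * \<epsilon> + \<epsilon> = e"
          by (simp add: algebra_simps)
      qed (use \<open>0 < e\<close> in \<open>simp add: \<epsilon>_def\<close>)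
      \<comment> \<open>\<open>P\<close> sees the trajectory only through the node as a set, so the
        choice made by \<open>SOME\<close> is a function of the node and \<open>G\<close> is
        non-anticipative.\<close>
      define P where "P N i h \<longleftrightarrow> (\<forall>S'\<in>N. L_node (node \<S> S' (Suc i)) (Suc i) \<longrightarrow>
          S' \<notin> arbitrage_moves \<S> \<longrightarrow> f (Suc i) S' \<le> f i S' + \<epsilon> + h * (S' (Suc i) - S' i))" for N i h
      \<comment> \<open>No position is held once \<tau> has been reached, so the value at \<tau>
        persists up to \<open>C\<close>.\<close>
      define G where "G i S' = (if \<tau> S' \<le> enat i then 0 else SOME h. P (node \<S> S' i) i h)" for i S'
      have G: "G \<in> strategies (node \<S> S j) j"
      proof (rule strategiesI)
        fix i S1 S2
        assume "j \<le> i" and S12: "S1 \<in> node \<S> S j" "S2 \<in> node \<S> S j"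
          and "\<And>k. j \<le> k \<Longrightarrow> k \<le> i \<Longrightarrow> S1 k = S2 k"
        then have eq: "S1 k = S2 k" if "k \<le> i" for k
          using that node_agree [OF S12(1), of k] node_agree [OF S12(2), of k] by (cases "j \<le> k") auto
        then have "node \<S> S1 i = node \<S> S2 i"
          by (auto simp: node_def)
        moreover have "S1 \<in> \<S>" "S2 \<in> \<S>" "S2 \<in> node \<S> S1 i" "S1 \<in> node \<S> S2 i"
          using S12 eq by (auto simp: node_def)
        then have "\<tau> S1 \<le> enat i \<longleftrightarrow> \<tau> S2 \<le> enat i"
          using stopping_time_eq [OF assms(5)] by metis
        ultimately show "G i S1 = G i S2"
          by (simp add: G_def)
      qed
      have G_step: "f (Suc i) S' \<le> f i S' + \<epsilon> + G i S' * (S' (Suc i) - S' i)"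
        if S': "S' \<in> \<S>" "S' \<notin> B" and i: "enat i < \<tau> S'" for S' i
      proof -
        have "\<exists>h. P (node \<S> S' i) i h"
          unfolding P_def using S' \<epsilon> f by (intro single_position E) (auto simp: B_def)
        then have "P (node \<S> S' i) i (G i S')"
          unfolding G_def using i by (metis not_le someI_ex)
        then show ?thesis
          unfolding P_def using S' self_in_node [OF S'(1)] by (auto simp: B_def EL_def)
      qed
      define V0 where "V0 = f j S + C * \<epsilon>"
      have hedge: "f\<^sub>\<tau> S' \<le> ereal (portfolio j V0 G C S')" if S': "S' \<in> node \<S> S j" "S' \<notin> B" for S'
      proof -
        have S'S: "S' \<in> \<S>" using S' by (simp add: node_def)
        obtain t where t: "\<tau> S' = enat t" "t \<le> C"
          using ord [OF S'S S'(2)] by (cases "\<tau> S'") auto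
        have "\<rho> S' = \<rho> S"
          using stopping_time_eq [OF assms(4) S(1) S'(1)] j(1) by simp
        then have "j \<le> t"
          using ord(1) [OF S'S S'(2)] t j by simp
        \<comment> \<open>Telescoping: each step uses up one \<epsilon> of capital. The bound by
          \<open>t\<close> is needed because the one-step inequality for \<open>G\<close> holds only
          before \<tau>.\<close>
        have "f n S' \<le> portfolio j (f j S + (n - j) * \<epsilon>) G n S'" if "j \<le> n" "n \<le> t" for n
          using that
        proof (induction n rule: dec_induct)
          case base
          then show ?case
            using f_eq [OF S(1) S'(1)] by (simp add: portfolio_def)
        next
          case (step n)
          then show ?case
            using G_step [OF S'S S'(2), of n] t
            by (simp add: portfolio_def Suc_diff_le distrib_right)
        qed
        from this [OF \<open>j \<le> t\<close> order_refl]
        have "f t S' \<le> f j S + (t - j) * \<epsilon> + (\<Sum>i=j..<t. G i S' * (S' (Suc i) - S' i))"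
          by (simp add: portfolio_def)
        also have "(\<Sum>i=j..<t. G i S' * (S' (Suc i) - S' i)) = (\<Sum>i=j..<C. G i S' * (S' (Suc i) - S' i))"
          using t by (intro sum.mono_neutral_left) (auto simp: G_def)
        also have "(t - j) * \<epsilon> \<le> C * \<epsilon>"
          using \<epsilon> t by (intro mult_right_mono) auto
        finally have "f t S' \<le> portfolio j V0 G C S'"
          by (simp add: portfolio_def V0_def)
        moreover have "f\<^sub>\<tau> S' = ereal (f t S')"
          using assms(9) S'S t by (simp add: is_stopped_def)
        ultimately show ?thesis by simp
      qed
      have "negligible (node \<S> S j) j B"
        using S by (auto simp: D_def)
      \<comment> \<open>On \<open>B\<close> nothing is known about \<open>f\<^sub>\<tau>\<close>,
        which may even be infinite; a cover with infinite payoff there handles this at cost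
        \<epsilon>.\<close>
      from negligibleD [OF this \<epsilon>(1)]
      obtain V H where VH: "\<forall>m. nonneg_portfolios (node \<S> S j) j (V m) (H m)"
        "(\<Sum>m. ereal (V m)) \<le> ereal \<epsilon>"
        "\<forall>S'\<in>node \<S> S j \<inter> B. (\<Sum>m. liminf_portfolio j (V m) (H m) S') = \<infinity>"
        by (elim exE conjE) (rule that)
      have "f\<^sub>\<tau> S' \<le> ereal (portfolio j V0 G C S') + (\<Sum>m. liminf_portfolio j (V m) (H m) S')"
        if S': "S' \<in> node \<S> S j" for S'
      proof (cases "S' \<in> B")
        case True
        then show ?thesis using VH(3) S' by simp
      next
        case False
        have nonneg: "0 \<le> (\<Sum>m. liminf_portfolio j (V m) (H m) S')"
          by (intro suminf_0_le liminf_portfolio_nonneg [OF VH(1)[rule_format] S'])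
        then show ?thesis
          using add_mono [OF hedge [OF S' False] nonneg] by simp
      qed
      then have "sigma_node (node \<S> S j) j f\<^sub>\<tau> \<le> ereal V0 + (\<Sum>m. ereal (V m))"
        unfolding sigma_node_def using G j(2) VH(1)
        by (intro Inf_lower CollectI exI [of _ V0] exI [of _ G] exI [of _ C] exI [of _ V] exI [of _ H] conjI)
          simp_all
      also have "\<dots> \<le> ereal V0 + ereal \<epsilon>"
        using VH(2) by (intro add_left_mono)
      also have "\<dots> = ereal (f j S) + ereal e"
        using \<epsilon>(2) by (simp add: V0_def)
      finally show ?thesis .
    qed
    then have "sigma_node (node \<S> S j) j f\<^sub>\<tau> \<le> ereal (f j S)"
      by (rule ereal_le_epsilon2)
    moreover have "f\<^sub>\<rho> S = ereal (f j S)"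
      using assms(8) S(1) j(1) unfolding is_stopped_def by blast
    ultimately show ?thesis
      by (simp add: sigma_bar_stop_def sigma_bar_def j(1))
  qed
  then show ?thesis
    unfolding ae_def using null by (intro exI [of _ "B \<union> D"]) simp
qed

end
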